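(* Let $m\ge1$, $K\ge1$ be integers, $1<p<\infty$, $\lambda>0$, and $\ell=m$. Let $L_1,\dots,L_N$ be bounded linear functionals on $W_{m,p}[0,1]$ with $L_if=\langle h_i,f\rangle$, where $\{h_i\}$ separate polynomials of degree $m-1$, let $y\in\mathbb R^N$, and let $\rho_1,\dots,\rho_N$ be strictly convex continuous functions on $\mathbb R$. For $\mathbf x=(x_1,\dots,x_K)$ with $0\le x_1\le\dots\le x_K\le1$ (and $x_0:=0$, $x_{K+1}:=1$), let $$V^{K,m}_{m,p}[\mathbf x]=\{f\in W_{m,p}:(-1)^{k-1}f^{(m)}(t)\ge0 \text{ for a.e. } t\in[x_{k-1},x_k],\ k=1,\dots,K+1\}$$ and $$\Phi(\mathbf x)=\inf_{f\in V^{K,m}_{m,p}[\mathbf x]}\Big\{\frac{\lambda}{p}\int_0^1|f^{(m)}(s)|^pds+\sum_{i=1}^N\rho_i(\langle h_i,f\rangle-y_i)\Big\}.$$ Then there exist change points $0\le x_1\le\dots\le x_K\le1$ at which $\Phi$ attains its minimum over $\{\mathbf x\in[0,1]^K: x_1\le\dots\le x_K\}$.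
   Context: $W_{m,p}[0,1]$ is the Sobolev space of functions with $f,\dots,f^{(m-1)}$ absolutely continuous and $f^{(m)}\in L_p[0,1]$. $h_i(s)=L_i\delta(s-\cdot)$ and $\langle\cdot,\cdot\rangle$ is the $L_2$ (distributional) pairing. $\{h_i\}$ separate polynomials of degree $m-1$ if $\langle h_i,\sum_{k<m}c_kt^k\rangle=0$ for all $i$ implies all $c_k=0$. *)

theory Defs
  imports "HOL-Analysis.Analysis"
begin

definition strictly_convex_on :: "real set \<Rightarrow> (real \<Rightarrow> real) \<Rightarrow> bool" where
  "strictly_convex_on S g \<longleftrightarrow> convex S \<and>
     (\<forall>x\<in>S. \<forall>z\<in>S. \<forall>u::real. x \<noteq> z \<longrightarrow> 0 < u \<longrightarrow> u < 1 \<longrightarrow>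
        g (u * x + (1 - u) * z) < u * g x + (1 - u) * g z)"

text \<open>D is a family of derivatives witnessing membership of f in the Sobolev space
  W_{m,p}[0,1]: D 0 = f on [0,1]; for k < m, D k is absolutely continuous with
  derivative D (k+1) (i.e. D k is the indefinite integral of the Lebesgue integrable
  function D (k+1)); and D m is in L_p[0,1].\<close>
definition sob_derivs :: "nat \<Rightarrow> real \<Rightarrow> (real \<Rightarrow> real) \<Rightarrow> (nat \<Rightarrow> real \<Rightarrow> real) \<Rightarrow> bool" where
  "sob_derivs m p f D \<longleftrightarrow>
     (\<forall>x\<in>{0..1}. D 0 x = f x) \<and>
     (\<forall>k<m. D (Suc k) absolutely_integrable_on {0..1} \<and>
            (\<forall>x\<in>{0..1}. D k x = D k 0 + integral {0..x} (D (Suc k)))) \<and>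
     D m \<in> borel_measurable (lebesgue_on {0..1}) \<and>
     (\<lambda>t. \<bar>D m t\<bar> powr p) integrable_on {0..1}"

definition in_sobolev :: "nat \<Rightarrow> real \<Rightarrow> (real \<Rightarrow> real) \<Rightarrow> bool" where
  "in_sobolev m p f \<longleftrightarrow> (\<exists>D. sob_derivs m p f D)"

definition sob_norm :: "nat \<Rightarrow> real \<Rightarrow> (nat \<Rightarrow> real \<Rightarrow> real) \<Rightarrow> real" where
  "sob_norm m p D = (\<Sum>k\<le>m. (integral {0..1} (\<lambda>t. \<bar>D k t\<bar> powr p)) powr (1 / p))"

definition bounded_linear_functional_W :: "nat \<Rightarrow> real \<Rightarrow> ((real \<Rightarrow> real) \<Rightarrow> real) \<Rightarrow> bool" where
  "bounded_linear_functional_W m p L \<longleftrightarrow>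
     (\<forall>f g a b. in_sobolev m p f \<longrightarrow> in_sobolev m p g \<longrightarrow>
         L (\<lambda>t. a * f t + b * g t) = a * L f + b * L g) \<and>
     (\<exists>C. \<forall>f D. sob_derivs m p f D \<longrightarrow> \<bar>L f\<bar> \<le> C * sob_norm m p D)"

definition separates_polys :: "nat \<Rightarrow> nat \<Rightarrow> (nat \<Rightarrow> (real \<Rightarrow> real) \<Rightarrow> real) \<Rightarrow> bool" where
  "separates_polys m N L \<longleftrightarrow>
     (\<forall>c::nat \<Rightarrow> real. (\<forall>i\<in>{1..N}. L i (\<lambda>t. \<Sum>k<m. c k * t ^ k) = 0) \<longrightarrow> (\<forall>k<m. c k = 0))"

definition ext_pts :: "nat \<Rightarrow> (nat \<Rightarrow> real) \<Rightarrow> nat \<Rightarrow> real" where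
  "ext_pts K x k = (if k = 0 then 0 else if k = Suc K then 1 else x k)"

definition change_pts :: "nat \<Rightarrow> (nat \<Rightarrow> real) set" where
  "change_pts K = {x. \<forall>k\<le>K. ext_pts K x k \<le> ext_pts K x (Suc k)}"

definition in_V :: "nat \<Rightarrow> real \<Rightarrow> nat \<Rightarrow> (nat \<Rightarrow> real) \<Rightarrow> (real \<Rightarrow> real) \<Rightarrow> (nat \<Rightarrow> real \<Rightarrow> real) \<Rightarrow> bool" where
  "in_V m p K x f D \<longleftrightarrow> sob_derivs m p f D \<and>
     (\<forall>k\<in>{1..Suc K}. AE t in lebesgue.
         t \<in> {ext_pts K x (k - 1) .. ext_pts K x k} \<longrightarrow> (-1) ^ (k - 1) * D m t \<ge> 0)"

definition objective :: "nat \<Rightarrow> real \<Rightarrow> real \<Rightarrow> nat \<Rightarrow> (nat \<Rightarrow> (real \<Rightarrow> real) \<Rightarrow> real)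
     \<Rightarrow> (nat \<Rightarrow> real) \<Rightarrow> (nat \<Rightarrow> real \<Rightarrow> real) \<Rightarrow> (real \<Rightarrow> real) \<Rightarrow> (nat \<Rightarrow> real \<Rightarrow> real) \<Rightarrow> real" where
  "objective m p lam N L y rho f D =
     lam / p * integral {0..1} (\<lambda>s. \<bar>D m s\<bar> powr p) + (\<Sum>i=1..N. rho i (L i f - y i))"

definition Phi :: "nat \<Rightarrow> real \<Rightarrow> real \<Rightarrow> nat \<Rightarrow> nat \<Rightarrow> (nat \<Rightarrow> (real \<Rightarrow> real) \<Rightarrow> real)
     \<Rightarrow> (nat \<Rightarrow> real) \<Rightarrow> (nat \<Rightarrow> real \<Rightarrow> real) \<Rightarrow> (nat \<Rightarrow> real) \<Rightarrow> ereal" where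
  "Phi m p lam K N L y rho x =
     Inf {ereal (objective m p lam N L y rho f D) | f D. in_V m p K x f D}"

end

theory Submission
  imports Defs
begin

text \<open>
  \<open>Phi\<close> is lower semicontinuous on the compact set of change point vectors, with values in the
  extended reals. To compare \<open>x\<close> with a nearby \<open>x'\<close>, take \<open>f\<close> admissible for \<open>x'\<close> and delete its
  \<open>m\<close>-th derivative on small neighbourhoods of the change points of \<open>x\<close>; the result is admissible
  for \<open>x\<close> and has no larger energy. Since \<open>p > 1\<close>, a bounded functional of \<open>g\<close> in \<open>L\<^sub>p\<close> is uniformly
  small on functions of bounded norm with small support, so the data change little.
  The data term need not be coercive along polynomials, hence the data \<open>L i f\<close> may be unbounded.
  Writing \<open>f = q + u\<close> with \<open>u\<close> the \<open>m\<close>-fold integral of the \<open>m\<close>-th derivative of \<open>f\<close> and letting \<open>w\<close>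
  be the deleted part, one uses \<open>f - \<theta> q - w = (1 - \<theta>) f + \<theta> (u - w / \<theta>)\<close> as competitor: by convexity
  its data term exceeds that of \<open>f\<close> by an amount controlled by the bounded data of \<open>u - w / \<theta>\<close>.
\<close>

section \<open>Functions in L_p on the unit interval and their energy\<close>

definition Lp_fun :: "real \<Rightarrow> (real \<Rightarrow> real) \<Rightarrow> bool" where
  "Lp_fun p g \<longleftrightarrow> g \<in> borel_measurable (lebesgue_on {0..1}) \<and>
     (\<lambda>t. \<bar>g t\<bar> powr p) integrable_on {0..1}"

text \<open>The p-th power of the L_p norm. Unlike the norm itself it is additive over disjoint
  supports.\<close>

definition Lp_energy :: "real \<Rightarrow> (real \<Rightarrow> real) \<Rightarrow> real" where
  "Lp_energy p g = integral {0..1} (\<lambda>t. \<bar>g t\<bar> powr p)"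

lemma Lp_energy_nonneg: "0 \<le> Lp_energy p g"
  unfolding Lp_energy_def by (cases "(\<lambda>t. \<bar>g t\<bar> powr p) integrable_on {0..1}")
    (auto intro: integral_nonneg simp: not_integrable_integral)

lemma Lp_fun_dominated:
  assumes "g \<in> borel_measurable (lebesgue_on {0..1})" "F integrable_on {0..1}"
    and "\<And>t. t \<in> {0..1} \<Longrightarrow> \<bar>g t\<bar> powr p \<le> F t"
  shows "Lp_fun p g"
proof -
  have "(\<lambda>t. \<bar>g t\<bar> powr p) \<in> borel_measurable (lebesgue_on {0..1})"
    using assms(1) by measurable
  then have "(\<lambda>t. \<bar>g t\<bar> powr p) integrable_on {0..1}"
    by (rule measurable_bounded_by_integrable_imp_integrable[where g = F]) (use assms in auto)
  then show ?thesis
    using assms(1) by (simp add: Lp_fun_def)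
qed

text \<open>The interval has length one, so the constant in the pointwise bound of
  \<open>\<bar>g t\<bar>\<close> by \<open>1 + \<bar>g t\<bar> powr p\<close> integrates to
  one.\<close>

lemma Lp_fun_absolutely_integrable:
  assumes "Lp_fun p g" "1 < p"
  shows "g absolutely_integrable_on {0..1}"
    and "integral {0..1} (\<lambda>t. \<bar>g t\<bar>) \<le> 1 + Lp_energy p g"
proof -
  have le: "\<bar>g t\<bar> \<le> 1 + \<bar>g t\<bar> powr p" for t
  proof (cases "\<bar>g t\<bar> \<le> 1")
    case False
    then have "\<bar>g t\<bar> powr 1 \<le> \<bar>g t\<bar> powr p"
      using assms by (intro powr_mono) auto
    then show ?thesis using False by simp
  qed (simp add: add_increasing2)
  have F: "(\<lambda>t. 1 + \<bar>g t\<bar> powr p) integrable_on {0..1}"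
    using assms(1) by (intro integrable_add) (auto simp: Lp_fun_def)
  show g: "g absolutely_integrable_on {0..1}"
    by (rule measurable_bounded_by_integrable_imp_absolutely_integrable[OF _ _ F])
      (use assms(1) le in \<open>auto simp: Lp_fun_def\<close>)
  have "integral {0..1} (\<lambda>t. \<bar>g t\<bar>) \<le> integral {0..1} (\<lambda>t. 1 + \<bar>g t\<bar> powr p)"
    using g le by (intro integral_le F) (auto simp: absolutely_integrable_on_def)
  also have "\<dots> = 1 + Lp_energy p g"
    using assms(1) by (subst integral_add) (auto simp: Lp_fun_def Lp_energy_def)
  finally show "integral {0..1} (\<lambda>t. \<bar>g t\<bar>) \<le> 1 + Lp_energy p g" .
qed

lemma Lp_fun_scale:
  assumes "Lp_fun p g"
  shows "Lp_fun p (\<lambda>t. a * g t)" and "Lp_energy p (\<lambda>t. a * g t) = \<bar>a\<bar> powr p * Lp_energy p g"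
  using assms integrable_cmul[of "\<lambda>t. \<bar>g t\<bar> powr p" "{0..1}" "\<bar>a\<bar> powr p"]
  by (auto simp: Lp_fun_def Lp_energy_def abs_mult powr_mult)

lemma Lp_fun_zero: "Lp_fun p (\<lambda>t. 0)" "Lp_energy p (\<lambda>t. 0) = 0"
  by (auto simp: Lp_fun_def Lp_energy_def)

lemma Lp_fun_add:
  assumes "Lp_fun p g" "Lp_fun p h" "1 < p"
  shows "Lp_fun p (\<lambda>t. g t + h t)"
proof (rule Lp_fun_dominated)
  show "(\<lambda>t. g t + h t) \<in> borel_measurable (lebesgue_on {0..1})"
    using assms by (auto simp: Lp_fun_def)
  show "(\<lambda>t. 2 powr p * (\<bar>g t\<bar> powr p + \<bar>h t\<bar> powr p)) integrable_on {0..1}"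
    using assms by (auto simp: Lp_fun_def intro!: integrable_add)
  fix t
  have "\<bar>g t + h t\<bar> powr p \<le> (2 * max \<bar>g t\<bar> \<bar>h t\<bar>) powr p"
    using assms(3) by (intro powr_mono2) auto
  also have "\<dots> = 2 powr p * max \<bar>g t\<bar> \<bar>h t\<bar> powr p"
    by (simp add: powr_mult)
  also have "\<dots> \<le> 2 powr p * (\<bar>g t\<bar> powr p + \<bar>h t\<bar> powr p)"
    by (intro mult_left_mono) (auto simp: max_def)
  finally show "\<bar>g t + h t\<bar> powr p \<le> 2 powr p * (\<bar>g t\<bar> powr p + \<bar>h t\<bar> powr p)" .
qed

lemma Lp_fun_lincomb:
  assumes "Lp_fun p g" "Lp_fun p h" "1 < p"
  shows "Lp_fun p (\<lambda>t. a * g t + b * h t)"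
  using assms by (intro Lp_fun_add Lp_fun_scale)

lemma Lp_fun_restrict:
  assumes "Lp_fun p g" "S \<in> sets lebesgue" "0 < p"
  shows "Lp_fun p (\<lambda>t. indicat_real S t * g t)"
    and "Lp_energy p (\<lambda>t. indicat_real S t * g t) \<le> Lp_energy p g"
proof -
  have "indicat_real S \<in> borel_measurable (lebesgue_on {0..1})"
    using assms(2) by (intro measurable_restrict_space1) auto
  then have meas: "(\<lambda>t. indicat_real S t * g t) \<in> borel_measurable (lebesgue_on {0..1})"
    using assms(1) by (auto simp: Lp_fun_def)
  have le: "\<bar>indicat_real S t * g t\<bar> powr p \<le> \<bar>g t\<bar> powr p" for t
    by (auto simp: indicator_def)
  show *: "Lp_fun p (\<lambda>t. indicat_real S t * g t)"
    by (rule Lp_fun_dominated[OF meas, of "\<lambda>t. \<bar>g t\<bar> powr p"]) (use assms le in \<open>auto simp: Lp_fun_def\<close>)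
  show "Lp_energy p (\<lambda>t. indicat_real S t * g t) \<le> Lp_energy p g"
    unfolding Lp_energy_def using * assms(1) le by (intro integral_le) (auto simp: Lp_fun_def)
qed

lemma Lp_energy_add_disjoint:
  assumes "Lp_fun p g" "Lp_fun p h" "\<And>t. g t = 0 \<or> h t = 0"
  shows "Lp_energy p (\<lambda>t. g t + h t) = Lp_energy p g + Lp_energy p h"
proof -
  have "\<bar>g t + h t\<bar> powr p = \<bar>g t\<bar> powr p + \<bar>h t\<bar> powr p" for t
    using assms(3)[of t] by auto
  then show ?thesis
    using assms by (simp add: Lp_energy_def Lp_fun_def integral_add)
qed

lemma Lp_energy_restrict_tendsto_0:
  assumes h: "Lp_fun p h" and p: "0 < p" and S: "\<And>n. S n \<in> sets lebesgue" "decseq S" "(\<Inter>n. S n) = {}"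
  shows "(\<lambda>n. Lp_energy p (\<lambda>t. indicat_real (S n) t * h t)) \<longlonglongrightarrow> 0"
proof -
  have lim: "(\<lambda>n. \<bar>indicat_real (S n) t * h t\<bar> powr p) \<longlonglongrightarrow> 0" for t
  proof -
    obtain n0 where "t \<notin> S n0" using S(3) by auto
    then have "t \<notin> S n" if "n \<ge> n0" for n
      using S(2) that by (auto simp: decseq_def)
    then have "\<forall>\<^sub>F n in sequentially. \<bar>indicat_real (S n) t * h t\<bar> powr p = 0"
      by (intro eventually_sequentiallyI[of n0]) auto
    then show ?thesis by (rule tendsto_eventually)
  qed
  have "(\<lambda>n. integral {0..1} (\<lambda>t. \<bar>indicat_real (S n) t * h t\<bar> powr p)) \<longlonglongrightarrow> integral {0..1} (\<lambda>t::real. 0::real)"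
  proof (rule dominated_convergence(2))
    show "(\<lambda>t. \<bar>indicat_real (S n) t * h t\<bar> powr p) integrable_on {0..1}" for n
      using Lp_fun_restrict(1)[OF h S(1) p] by (simp add: Lp_fun_def)
    show "(\<lambda>t. \<bar>h t\<bar> powr p) integrable_on {0..1}"
      using h by (simp add: Lp_fun_def)
    show "norm (\<bar>indicat_real (S n) t * h t\<bar> powr p) \<le> \<bar>h t\<bar> powr p" for n t
      by (auto simp: indicator_def)
  qed (rule lim)
  then show ?thesis by (simp add: Lp_energy_def)
qed

section \<open>Bounded linear functionals on L_p\<close>

lemma functional_bound_by_energy:
  assumes "\<And>g a. Lp_fun p g \<Longrightarrow> v (\<lambda>t. a * g t) = a * v g"
    and "\<And>g. Lp_fun p g \<Longrightarrow> Lp_energy p g \<le> 1 \<Longrightarrow> \<bar>v g\<bar> \<le> C"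
    and "Lp_fun p g" "Lp_energy p g \<le> r powr p" "0 < r"
  shows "\<bar>v g\<bar> \<le> C * r"
proof -
  \<comment> \<open>Energy at most \<open>r powr p\<close> means norm at most \<open>r\<close>, so
    division by \<open>r\<close> moves \<open>g\<close> into the unit ball, where the bound
    \<open>C\<close> holds.\<close>
  have "Lp_energy p (\<lambda>t. (1/r) * g t) = (1/r) powr p * Lp_energy p g"
    using assms(3,5) Lp_fun_scale(2)[of p g "1/r"] by simp
  also have "\<dots> \<le> (1/r) powr p * r powr p"
    using assms(4) by (intro mult_left_mono) auto
  also have "\<dots> = 1"
    using assms(5) by (simp flip: powr_mult)
  finally have "\<bar>v (\<lambda>t. (1/r) * g t)\<bar> \<le> C"
    using assms(2,3) Lp_fun_scale(1) by blast
  then have "\<bar>v g\<bar> / r \<le> C"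
    using assms(1)[OF assms(3), of "1/r"] assms(5) by simp
  then show ?thesis
    using assms(5) by (simp add: field_simps)
qed

text \<open>Otherwise one could collect \<open>J\<close> disjointly supported functions of norm at most 1 on each of
  which \<open>v\<close> is at least \<open>e/2\<close>; their sum has norm at most \<open>J powr (1/p)\<close>, which is of smaller order
  than \<open>J\<close> since \<open>p > 1\<close>.\<close>
lemma functional_small_on_small_support:
  assumes p: "1 < p"
    and lin: "\<And>g h a b. Lp_fun p g \<Longrightarrow> Lp_fun p h \<Longrightarrow> v (\<lambda>t. a * g t + b * h t) = a * v g + b * v h"
    and bd: "\<And>g. Lp_fun p g \<Longrightarrow> Lp_energy p g \<le> 1 \<Longrightarrow> \<bar>v g\<bar> \<le> C"
    and S: "\<And>n. S n \<in> sets lebesgue" "decseq S" "(\<Inter>n. S n) = {}"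
    and e: "0 < e"
  shows "\<exists>n. \<forall>g. Lp_fun p g \<longrightarrow> Lp_energy p g \<le> 1 \<longrightarrow> (\<forall>t. t \<notin> S n \<longrightarrow> g t = 0) \<longrightarrow> \<bar>v g\<bar> \<le> e"
proof (rule ccontr)
  assume "\<not> ?thesis"
  then have ex: "\<exists>g. Lp_fun p g \<and> Lp_energy p g \<le> 1 \<and> (\<forall>t. t \<notin> S n \<longrightarrow> g t = 0) \<and> \<bar>v g\<bar> > e" for n
    by (meson not_le)
  have scale: "v (\<lambda>t. a * g t) = a * v g" if "Lp_fun p g" for g a
    using lin[OF that that, of a 0] by simp
  \<comment> \<open>A positive bound, by which one can divide in the choice of \<open>r\<close>
    below.\<close>
  define C' where "C' = max C 1"
  have C': "0 < C'" by (simp add: C'_def)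
  have bd': "\<bar>v g\<bar> \<le> C'" if "Lp_fun p g" "Lp_energy p g \<le> 1" for g
    using bd[OF that] by (simp add: C'_def)
  have ex: "\<exists>g. Lp_fun p g \<and> Lp_energy p g \<le> 1 \<and> (\<forall>t. t \<notin> S n \<longrightarrow> g t = 0) \<and> v g > e" for n
  proof -
    obtain g where g: "Lp_fun p g" "Lp_energy p g \<le> 1" "\<forall>t. t \<notin> S n \<longrightarrow> g t = 0" "\<bar>v g\<bar> > e"
      using ex[of n] by blast
    define h where "h = (\<lambda>t. sgn (v g) * g t)"
    have "v h = \<bar>v g\<bar>" using scale[OF g(1), of "sgn (v g)"] by (simp add: h_def abs_sgn mult.commute)
    moreover have "\<bar>sgn (v g)\<bar> = 1" using g(4) e by (auto simp: sgn_if)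
    ultimately show ?thesis
      using g Lp_fun_scale[OF g(1), of "sgn (v g)"] unfolding h_def by (intro exI[of _ h]) (auto simp: h_def)
  qed
  \<comment> \<open>The set \<open>S n\<close> on which \<open>g\<close> vanishes is kept free for
    the support of the next function.\<close>
  have build: "\<exists>g n. Lp_fun p g \<and> (\<forall>t\<in>S n. g t = 0) \<and> Lp_energy p g \<le> real J \<and> v g \<ge> real J * e / 2" for J
  proof (induction J)
    case 0
    have "v (\<lambda>t. 0) = 0" using scale[OF Lp_fun_zero(1), of 0] by simp
    then show ?case
      by (intro exI[of _ "\<lambda>t. 0"]) (auto simp: Lp_fun_zero)
  next
    case (Suc J)
    then obtain g n where g: "Lp_fun p g" "\<forall>t\<in>S n. g t = 0" "Lp_energy p g \<le> real J" "v g \<ge> real J * e / 2"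
      by blast
    obtain h where h: "Lp_fun p h" "Lp_energy p h \<le> 1" "\<forall>t. t \<notin> S n \<longrightarrow> h t = 0" "v h > e"
      using ex[of n] by blast
    \<comment> \<open>The new function \<open>h\<close> may fill all of \<open>S n\<close>, so its
      part on a much smaller \<open>S n'\<close> is cut off. With this \<open>r\<close> the cut-off
      part costs at most \<open>e / 2\<close> of \<open>v h\<close>, and the remainder
      \<open>h2\<close> keeps at least \<open>e / 2\<close>.\<close>
    define r where "r = e / (2 * C')"
    have r: "0 < r" using e C' by (simp add: r_def)
    have "\<forall>\<^sub>F n in sequentially. Lp_energy p (\<lambda>t. indicat_real (S n) t * h t) < r powr p"
      using Lp_energy_restrict_tendsto_0[OF h(1) _ S] p r by (intro order_tendstoD) auto
    then have "\<forall>\<^sub>F n' in sequentially. Lp_energy p (\<lambda>t. indicat_real (S n') t * h t) < r powr p \<and> n' \<ge> n"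
      using eventually_ge_at_top by (rule eventually_conj)
    then obtain n' where n': "Lp_energy p (\<lambda>t. indicat_real (S n') t * h t) < r powr p" "n' \<ge> n"
      by (auto simp: eventually_sequentially)
    define h1 where "h1 = (\<lambda>t. indicat_real (S n') t * h t)"
    define h2 where "h2 = (\<lambda>t. indicat_real (- S n') t * h t)"
    have S': "- S n' \<in> sets lebesgue" using S(1)[of n'] sets.compl_sets[of "S n'" lebesgue] by (simp add: Compl_eq_Diff_UNIV)
    have h1: "Lp_fun p h1" using Lp_fun_restrict(1)[OF h(1) S(1)] p by (simp add: h1_def)
    have h2: "Lp_fun p h2" "Lp_energy p h2 \<le> 1"
      using Lp_fun_restrict[OF h(1) S'] p h(2) by (simp_all add: h2_def)
    have "\<bar>v h1\<bar> \<le> C' * r"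
      by (rule functional_bound_by_energy[OF scale bd' h1]) (use n' r in \<open>auto simp: h1_def\<close>)
    then have v1: "\<bar>v h1\<bar> \<le> e / 2" using C' by (simp add: r_def)
    have "h = (\<lambda>t. 1 * h1 t + 1 * h2 t)"
      by (auto simp: h1_def h2_def indicator_def)
    then have "v h = v h1 + v h2"
      using lin[OF h1 h2(1), of 1 1] by simp
    then have v2: "v h2 \<ge> e / 2" using v1 h(4) by linarith
    \<comment> \<open>\<open>h2\<close> lives on \<open>S n\<close> without \<open>S n'\<close>: it
      is disjoint from \<open>g\<close> and leaves \<open>S n'\<close> free for the next
      stage.\<close>
    have "S n' \<subseteq> S n" using S(2) n'(2) by (auto simp: decseq_def)
    then have dis: "g t = 0 \<or> h2 t = 0" "t \<in> S n' \<Longrightarrow> g t + h2 t = 0" for t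
      using g(2) h(3) by (auto simp: h2_def indicator_def)
    have "v (\<lambda>t. g t + h2 t) = v g + v h2"
      using lin[OF g(1) h2(1), of 1 1] by simp
    then show ?case
      using Lp_fun_add[OF g(1) h2(1) p] Lp_energy_add_disjoint[OF g(1) h2(1) dis(1)] dis(2) g h2 v2
      by (intro exI[of _ "\<lambda>t. g t + h2 t"] exI[of _ n']) (auto simp: field_simps)
  qed
  have "real J * e / 2 \<le> C' * real J powr (1 / p)" if "J \<ge> 1" for J
  proof -
    obtain g where g: "Lp_fun p g" "Lp_energy p g \<le> real J" "v g \<ge> real J * e / 2"
      using build[of J] by blast
    have "\<bar>v g\<bar> \<le> C' * real J powr (1 / p)"
      by (rule functional_bound_by_energy[OF scale bd' g(1)]) (use g p that in \<open>auto simp: powr_powr\<close>)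
    then show ?thesis using g(3) by linarith
  qed
  then have bound: "real J powr (1 - 1 / p) \<le> 2 * C' / e" if "J \<ge> 1" for J
    using that e by (simp add: powr_diff field_simps)
  define s where "s = 1 - 1 / p"
  have s: "0 < s" using p by (simp add: s_def)
  obtain J where J: "real J > (2 * C' / e) powr (1 / s)" using reals_Archimedean2 by blast
  then have "J \<ge> 1" using C' e by (cases J) (auto simp: not_less)
  have "((2 * C' / e) powr (1 / s)) powr s < real J powr s"
    using J s by (intro powr_less_mono2) auto
  moreover have "((2 * C' / e) powr (1 / s)) powr s = 2 * C' / e"
    using s C' e by (simp add: powr_powr)
  ultimately show False
    using bound[OF \<open>J \<ge> 1\<close>] by (simp add: s_def)
qed

section \<open>Iterated integrals as Sobolev functions\<close>

fun iterated_integral :: "nat \<Rightarrow> (real \<Rightarrow> real) \<Rightarrow> real \<Rightarrow> real" where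
  "iterated_integral 0 g = g"
| "iterated_integral (Suc k) g = (\<lambda>x. integral {0..x} (iterated_integral k g))"

lemma absolutely_integrable_iterated_integral:
  assumes "g absolutely_integrable_on {0..1}"
  shows "iterated_integral k g absolutely_integrable_on {0..1}"
proof (induction k)
  case (Suc k)
  then have "continuous_on {0..1} (iterated_integral (Suc k) g)"
    by (auto intro: indefinite_integral_continuous_1 simp: absolutely_integrable_on_def)
  then show ?case
    by (rule absolutely_integrable_continuous_real)
qed (use assms in simp)

lemma iterated_integral_lincomb:
  assumes g: "g absolutely_integrable_on {0..1}" and h: "h absolutely_integrable_on {0..1}"
    and "x \<in> {0..1}"
  shows "iterated_integral k (\<lambda>t. a * g t + b * h t) x
       = a * iterated_integral k g x + b * iterated_integral k h x"
  using assms(3)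
proof (induction k arbitrary: x)
  case (Suc k)
  have int: "iterated_integral k f integrable_on {0..x}" if "f absolutely_integrable_on {0..1}" for f
    using absolutely_integrable_iterated_integral[OF that, of k] Suc.prems
    by (auto simp: absolutely_integrable_on_def intro: integrable_subinterval_real)
  have "integral {0..x} (iterated_integral k (\<lambda>t. a * g t + b * h t))
      = integral {0..x} (\<lambda>t. a * iterated_integral k g t + b * iterated_integral k h t)"
    using Suc by (intro integral_cong) auto
  also have "\<dots> = a * integral {0..x} (iterated_integral k g) + b * integral {0..x} (iterated_integral k h)"
    using int[OF g] int[OF h] by (subst integral_add) (auto intro: integrable_on_mult_right)
  finally show ?case by simp
qed simp

text \<open>The first integration turns the L_1 norm into a sup bound; each further one runs over an
  interval of length at most one and preserves it.\<close>

lemma abs_iterated_integral_le: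
  assumes g: "g absolutely_integrable_on {0..1}" and "x \<in> {0..1}"
  shows "\<bar>iterated_integral (Suc k) g x\<bar> \<le> integral {0..1} (\<lambda>t. \<bar>g t\<bar>)"
  using assms(2)
proof (induction k arbitrary: x)
  case 0
  have g': "(\<lambda>t. \<bar>g t\<bar>) integrable_on {0..1}" "g integrable_on {0..1}"
    using g by (auto simp: absolutely_integrable_on_def)
  have sub: "(\<lambda>t. \<bar>g t\<bar>) integrable_on {0..x}" "g integrable_on {0..x}"
    using 0 by (auto intro: integrable_subinterval_real[OF g'(1)] integrable_subinterval_real[OF g'(2)])
  then have "norm (integral {0..x} g) \<le> integral {0..x} (\<lambda>t. \<bar>g t\<bar>)"
    by (intro integral_norm_bound_integral) auto
  also have "\<dots> \<le> integral {0..1} (\<lambda>t. \<bar>g t\<bar>)"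
    using 0 sub g' by (intro integral_subset_le) auto
  finally show ?case by simp
next
  case (Suc k)
  let ?I = "integral {0..1} (\<lambda>t. \<bar>g t\<bar>)"
  have "iterated_integral (Suc k) g integrable_on {0..1}"
    using absolutely_integrable_iterated_integral[OF g] by (simp only: absolutely_integrable_on_def)
  then have "iterated_integral (Suc k) g integrable_on {0..x}"
    by (rule integrable_subinterval_real) (use Suc.prems in auto)
  then have "norm (integral {0..x} (iterated_integral (Suc k) g)) \<le> integral {0..x} (\<lambda>t. ?I)"
    using Suc by (intro integral_norm_bound_integral) (auto simp del: iterated_integral.simps)
  also have "\<dots> = x * ?I"
    using Suc.prems by simp
  also have "\<dots> \<le> 1 * ?I"
    using Suc.prems g by (intro mult_right_mono integral_nonneg) (auto simp: absolutely_integrable_on_def)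
  finally show ?case by simp
qed

lemma sob_derivs_step:
  assumes "sob_derivs m p f D" "k < m"
  shows "D (Suc k) absolutely_integrable_on {0..1}"
    and "x \<in> {0..1} \<Longrightarrow> D k x = D k 0 + integral {0..x} (D (Suc k))"
  using assms unfolding sob_derivs_def by blast+

lemma sob_derivs_0: "sob_derivs m p f D \<Longrightarrow> x \<in> {0..1} \<Longrightarrow> D 0 x = f x"
  unfolding sob_derivs_def by blast

lemma sob_derivs_top: "sob_derivs m p f D \<Longrightarrow> Lp_fun p (D m)"
  by (simp add: sob_derivs_def Lp_fun_def)

lemma sob_derivs_lincomb:
  assumes f: "sob_derivs m p f D" and g: "sob_derivs m p g E" and p: "1 < p"
  shows "sob_derivs m p (\<lambda>t. a * f t + b * g t) (\<lambda>k t. a * D k t + b * E k t)"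
  unfolding sob_derivs_def
proof (intro conjI ballI allI impI)
  fix k assume k: "k < m"
  have abs: "D (Suc k) absolutely_integrable_on {0..1}" "E (Suc k) absolutely_integrable_on {0..1}"
    using sob_derivs_step(1)[OF f k] sob_derivs_step(1)[OF g k] .
  then show "(\<lambda>t. a * D (Suc k) t + b * E (Suc k) t) absolutely_integrable_on {0..1}"
    by (intro set_integral_add) auto
  fix x :: real assume x: "x \<in> {0..1}"
  have int: "D (Suc k) integrable_on {0..x}" "E (Suc k) integrable_on {0..x}"
    using abs x by (auto simp: absolutely_integrable_on_def intro: integrable_subinterval_real)
  have eq: "D k x = D k 0 + integral {0..x} (D (Suc k))" "E k x = E k 0 + integral {0..x} (E (Suc k))"
    using sob_derivs_step(2)[OF f k x] sob_derivs_step(2)[OF g k x] .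
  have "integral {0..x} (\<lambda>t. a * D (Suc k) t + b * E (Suc k) t)
      = a * integral {0..x} (D (Suc k)) + b * integral {0..x} (E (Suc k))"
    using int by (subst integral_add) (auto intro: integrable_on_mult_right)
  then show "a * D k x + b * E k x = a * D k 0 + b * E k 0
        + integral {0..x} (\<lambda>t. a * D (Suc k) t + b * E (Suc k) t)"
    using eq by (simp add: algebra_simps)
qed (use Lp_fun_lincomb[OF sob_derivs_top[OF f] sob_derivs_top[OF g] p, of a b]
     sob_derivs_0[OF f] sob_derivs_0[OF g] in \<open>auto simp: Lp_fun_def\<close>)

text \<open>This is the Taylor remainder at 0: the \<open>m\<close>-th derivative is
  \<open>g\<close> and all lower derivatives vanish at 0. A Sobolev function minus the remainder
  built from its own \<open>m\<close>-th derivative is thus a polynomial of degree below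
  \<open>m\<close> on the unit interval.\<close>

lemma sob_derivs_iterated_integral:
  assumes "Lp_fun p g" "1 < p"
  shows "sob_derivs m p (iterated_integral m g) (\<lambda>k. iterated_integral (m - k) g)"
  unfolding sob_derivs_def
proof (intro conjI ballI allI impI)
  fix k assume k: "k < m"
  show "iterated_integral (m - Suc k) g absolutely_integrable_on {0..1}"
    using assms by (intro absolutely_integrable_iterated_integral Lp_fun_absolutely_integrable)
  have "m - k = Suc (m - Suc k)" using k by simp
  then show "iterated_integral (m - k) g x = iterated_integral (m - k) g 0 + integral {0..x} (iterated_integral (m - Suc k) g)" for x
    by simp
qed (use assms in \<open>auto simp: Lp_fun_def\<close>)

text \<open>Each of the \<open>m + 1\<close> summands is at most 2: the top one by the energy bound,
  the others by the sup bound \<open>1 + Lp_energy p g\<close>.\<close>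

lemma sob_norm_iterated_integral_le:
  assumes g: "Lp_fun p g" "Lp_energy p g \<le> 1" and p: "1 < p"
  shows "sob_norm m p (\<lambda>k. iterated_integral (m - k) g) \<le> 2 * (real m + 1)"
proof -
  note abs = Lp_fun_absolutely_integrable[OF g(1) p]
  have "(integral {0..1} (\<lambda>t. \<bar>iterated_integral j g t\<bar> powr p)) powr (1 / p) \<le> 2" for j
  proof (cases j)
    case 0
    have "Lp_energy p g powr (1 / p) \<le> 1 powr (1 / p)"
      using g(2) p Lp_energy_nonneg by (intro powr_mono2) auto
    then show ?thesis using 0 by (simp add: Lp_energy_def)
  next
    case (Suc k)
    have le: "\<bar>iterated_integral j g t\<bar> powr p \<le> 2 powr p" if "t \<in> {0..1}" for t
      using abs_iterated_integral_le[OF abs(1) that, of k] abs(2) g(2) p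
      by (intro powr_mono2) (auto simp: Suc simp del: iterated_integral.simps)
    have meas: "iterated_integral j g \<in> borel_measurable (lebesgue_on {0..1})"
      using absolutely_integrable_iterated_integral[OF abs(1), of j] by (simp add: absolutely_integrable_measurable)
    have "Lp_fun p (iterated_integral j g)"
      by (rule Lp_fun_dominated[OF meas, of "\<lambda>_. 2 powr p"]) (use le in auto)
    then have "integral {0..1} (\<lambda>t. \<bar>iterated_integral j g t\<bar> powr p) \<le> integral {0..1} (\<lambda>t::real. 2 powr p)"
      using le by (intro integral_le) (auto simp: Lp_fun_def)
    then have "Lp_energy p (iterated_integral j g) \<le> 2 powr p" by (simp add: Lp_energy_def)
    then have "Lp_energy p (iterated_integral j g) powr (1 / p) \<le> (2 powr p) powr (1 / p)"
      using p Lp_energy_nonneg by (intro powr_mono2) auto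
    then show ?thesis using p by (simp add: Lp_energy_def powr_powr)
  qed
  then have "sob_norm m p (\<lambda>k. iterated_integral (m - k) g) \<le> (\<Sum>k\<le>m. 2)"
    unfolding sob_norm_def by (intro sum_mono)
  then show ?thesis by simp
qed

section \<open>Functionals on the Sobolev space\<close>

lemma sob_functional_lincomb:
  assumes "bounded_linear_functional_W m p L" "sob_derivs m p f D" "sob_derivs m p g E"
  shows "L (\<lambda>t. a * f t + b * g t) = a * L f + b * L g"
  using assms unfolding bounded_linear_functional_W_def in_sobolev_def by blast

text \<open>Functions here are total on the reals, so \<open>L\<close> must be shown to ignore
  values outside the unit interval. The same \<open>D\<close> serves \<open>f\<close> and
  \<open>g\<close>, hence their difference has a derivative family of norm 0 and boundedness of
  \<open>L\<close> kills it.\<close>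

lemma sob_functional_cong:
  assumes L: "bounded_linear_functional_W m p L" and f: "sob_derivs m p f D" and p: "1 < p"
    and eq: "\<And>t. t \<in> {0..1} \<Longrightarrow> g t = f t"
  shows "L g = L f"
proof -
  have "(\<forall>t\<in>{0..1}. D 0 t = g t) \<longleftrightarrow> (\<forall>t\<in>{0..1}. D 0 t = f t)" using eq by auto
  then have g: "sob_derivs m p g D" using f unfolding sob_derivs_def by blast
  have "sob_derivs m p (\<lambda>t. 1 * g t + (-1) * f t) (\<lambda>k t. 1 * D k t + (-1) * D k t)"
    by (rule sob_derivs_lincomb[OF g f p])
  moreover obtain C where "\<And>f D. sob_derivs m p f D \<Longrightarrow> \<bar>L f\<bar> \<le> C * sob_norm m p D"
    using L unfolding bounded_linear_functional_W_def by blast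
  ultimately have "\<bar>L (\<lambda>t. 1 * g t + (-1) * f t)\<bar> \<le> C * sob_norm m p (\<lambda>k t. 1 * D k t + (-1) * D k t)"
    by blast
  moreover have "sob_norm m p (\<lambda>k t. 1 * D k t + (-1) * D k t) = 0"
    using p by (simp add: sob_norm_def)
  moreover have "L (\<lambda>t. 1 * g t + (-1) * f t) = L g - L f"
    using sob_functional_lincomb[OF L g f, of 1 "-1"] by simp
  ultimately show ?thesis by simp
qed

lemma functional_iterated_integral_lincomb:
  assumes L: "bounded_linear_functional_W m p L" and p: "1 < p"
    and g: "Lp_fun p g" and h: "Lp_fun p h"
  shows "L (iterated_integral m (\<lambda>t. a * g t + b * h t))
       = a * L (iterated_integral m g) + b * L (iterated_integral m h)"
proof -
  note sg = sob_derivs_iterated_integral[OF g p, of m] and sh = sob_derivs_iterated_integral[OF h p, of m]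
  have "L (iterated_integral m (\<lambda>t. a * g t + b * h t))
      = L (\<lambda>t. a * iterated_integral m g t + b * iterated_integral m h t)"
    by (rule sob_functional_cong[OF L sob_derivs_lincomb[OF sg sh p] p])
      (rule iterated_integral_lincomb[OF Lp_fun_absolutely_integrable(1)[OF g p] Lp_fun_absolutely_integrable(1)[OF h p]])
  then show ?thesis
    using sob_functional_lincomb[OF L sg sh] by simp
qed

text \<open>Makes \<open>L\<close> composed with the \<open>m\<close>-fold integral a bounded
  functional on L_p, to which the smallness result for small supports applies.\<close>

lemma functional_iterated_integral_bounded:
  assumes L: "bounded_linear_functional_W m p L" and p: "1 < p"
  obtains C where "\<And>g. Lp_fun p g \<Longrightarrow> Lp_energy p g \<le> 1 \<Longrightarrow> \<bar>L (iterated_integral m g)\<bar> \<le> C"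
proof -
  obtain C where C: "\<And>f D. sob_derivs m p f D \<Longrightarrow> \<bar>L f\<bar> \<le> C * sob_norm m p D"
    using L unfolding bounded_linear_functional_W_def by blast
  have "\<bar>L (iterated_integral m g)\<bar> \<le> \<bar>C\<bar> * (2 * (real m + 1))" if g: "Lp_fun p g" "Lp_energy p g \<le> 1" for g
  proof -
    let ?n = "sob_norm m p (\<lambda>k. iterated_integral (m - k) g)"
    have "0 \<le> ?n" by (auto simp: sob_norm_def intro: sum_nonneg)
    have "\<bar>L (iterated_integral m g)\<bar> \<le> C * ?n"
      by (rule C[OF sob_derivs_iterated_integral[OF g(1) p]])
    \<comment> \<open>The constant in the definition of boundedness carries no sign.\<close>
    also have "\<dots> \<le> \<bar>C\<bar> * ?n"
      using \<open>0 \<le> ?n\<close> by (intro mult_right_mono) auto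
    also have "\<dots> \<le> \<bar>C\<bar> * (2 * (real m + 1))"
      using sob_norm_iterated_integral_le[OF g p] by (intro mult_left_mono) auto
    finally show ?thesis .
  qed
  then show ?thesis using that by blast
qed

section \<open>Convexity and boundedness of the data term\<close>

lemma strictly_convex_on_imp_le:
  assumes "strictly_convex_on UNIV g" "0 \<le> u" "u \<le> 1"
  shows "g (u * x + (1 - u) * z) \<le> u * g x + (1 - u) * g z"
proof (cases "x = z \<or> u = 0 \<or> u = 1")
  case True
  then show ?thesis by (auto simp: algebra_simps)
next
  case False
  then show ?thesis using assms unfolding strictly_convex_on_def
    by (metis UNIV_I less_eq_real_def)
qed

lemma data_term_convex:
  fixes rho :: "nat \<Rightarrow> real \<Rightarrow> real"
  assumes "\<forall>i\<in>{1..N}. strictly_convex_on UNIV (rho i)"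
    and L: "\<forall>i\<in>{1..N}. bounded_linear_functional_W m p (L i)"
    and f: "sob_derivs m p f D" and g: "sob_derivs m p g E" and u: "0 \<le> u" "u \<le> 1"
  shows "(\<Sum>i=1..N. rho i (L i (\<lambda>t. u * f t + (1 - u) * g t) - y i))
       \<le> u * (\<Sum>i=1..N. rho i (L i f - y i)) + (1 - u) * (\<Sum>i=1..N. rho i (L i g - y i))"
proof -
  have "rho i (L i (\<lambda>t. u * f t + (1 - u) * g t) - y i)
      \<le> u * rho i (L i f - y i) + (1 - u) * rho i (L i g - y i)" if i: "i \<in> {1..N}" for i
  proof -
    have "L i (\<lambda>t. u * f t + (1 - u) * g t) - y i = u * (L i f - y i) + (1 - u) * (L i g - y i)"
      using sob_functional_lincomb[OF _ f g, of "L i" u "1 - u"] L i by (simp add: algebra_simps)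
    then show ?thesis
      using strictly_convex_on_imp_le[of "rho i" u] assms(1) i u by simp
  qed
  then have "(\<Sum>i=1..N. rho i (L i (\<lambda>t. u * f t + (1 - u) * g t) - y i))
      \<le> (\<Sum>i=1..N. u * rho i (L i f - y i) + (1 - u) * rho i (L i g - y i))"
    by (rule sum_mono)
  then show ?thesis by (simp add: sum.distrib sum_distrib_left)
qed

text \<open>Continuity on a compact interval bounds each summand from above. The bound depends only
  on the size \<open>C\<close> of the data, so it is uniform over all competitors with such
  data.\<close>

lemma data_term_bounded:
  fixes rho :: "nat \<Rightarrow> real \<Rightarrow> real" and y :: "nat \<Rightarrow> real"
  assumes "\<forall>i\<in>{1..N}. continuous_on UNIV (rho i)"
  obtains M where "0 \<le> M"
    "\<And>z. (\<And>i. i \<in> {1..N} \<Longrightarrow> \<bar>z i\<bar> \<le> C) \<Longrightarrow> (\<Sum>i=1..N. rho i (z i - y i)) \<le> M"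
proof -
  have "\<forall>i\<in>{1..N}. \<exists>B. \<forall>s. \<bar>s\<bar> \<le> C \<longrightarrow> rho i (s - y i) \<le> B"
  proof
    fix i assume i: "i \<in> {1..N}"
    have "continuous_on {-C..C} (\<lambda>s. rho i (s - y i))"
      by (rule continuous_on_compose2[of UNIV "rho i"]) (use assms i in \<open>auto intro!: continuous_intros\<close>)
    then have "compact ((\<lambda>s. rho i (s - y i)) ` {-C..C})"
      by (rule compact_continuous_image) simp
    then have "bdd_above ((\<lambda>s. rho i (s - y i)) ` {-C..C})"
      by (intro bounded_imp_bdd_above compact_imp_bounded)
    then obtain B where "\<forall>s\<in>{-C..C}. rho i (s - y i) \<le> B"
      by (auto simp: bdd_above_def)
    then show "\<exists>B. \<forall>s. \<bar>s\<bar> \<le> C \<longrightarrow> rho i (s - y i) \<le> B"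
      by (intro exI[of _ B]) (metis abs_le_D1 abs_le_D2 atLeastAtMost_iff minus_le_iff)
  qed
  then obtain B where B: "\<And>i s. i \<in> {1..N} \<Longrightarrow> \<bar>s\<bar> \<le> C \<Longrightarrow> rho i (s - y i) \<le> B i"
    by metis
  show ?thesis
  proof
    show "0 \<le> (\<Sum>i=1..N. \<bar>B i\<bar>)" by (simp add: sum_nonneg)
    show "(\<Sum>i=1..N. rho i (z i - y i)) \<le> (\<Sum>i=1..N. \<bar>B i\<bar>)"
      if "\<And>i. i \<in> {1..N} \<Longrightarrow> \<bar>z i\<bar> \<le> C" for z
      using B that by (intro sum_mono) (meson abs_ge_self order_trans)
  qed
qed

section \<open>Moving the change points and lower semicontinuity of \<open>Phi\<close>\<close>

lemma Phi_le_objective: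
  "in_V m p K x f D \<Longrightarrow> Phi m p lam K N L y rho x \<le> ereal (objective m p lam N L y rho f D)"
  unfolding Phi_def by (intro Inf_lower) auto

text \<open>The change points themselves are removed so that these sets shrink to the empty set.\<close>
definition punctured_nbhd :: "nat \<Rightarrow> (nat \<Rightarrow> real) \<Rightarrow> nat \<Rightarrow> real set" where
  "punctured_nbhd K x n = (\<Union>k\<in>{1..K}. ball (x k) (1 / (real n + 1))) - x ` {1..K}"

lemma punctured_nbhd:
  shows "punctured_nbhd K x n \<in> sets lebesgue" "decseq (punctured_nbhd K x)"
    "(\<Inter>n. punctured_nbhd K x n) = {}"
proof -
  have "closed (x ` {1..K})" by (intro finite_imp_closed) auto
  then have "open (punctured_nbhd K x n)"
    unfolding punctured_nbhd_def by (intro open_Diff open_UN) auto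
  then show "punctured_nbhd K x n \<in> sets lebesgue" by auto
  show "decseq (punctured_nbhd K x)"
  proof (rule decseq_SucI)
    fix n
    have "1 / (real (Suc n) + 1) \<le> 1 / (real n + 1)" by (simp add: field_simps)
    then show "punctured_nbhd K x (Suc n) \<subseteq> punctured_nbhd K x n"
      unfolding punctured_nbhd_def by (intro Diff_mono UN_mono subset_ball) auto
  qed
  have "\<exists>n. t \<notin> punctured_nbhd K x n" for t
  proof (cases "t \<in> x ` {1..K}")
    case False
    have "\<forall>k\<in>{1..K}. \<forall>\<^sub>F n in sequentially. 1 / (real n + 1) < dist (x k) t"
    proof
      fix k assume "k \<in> {1..K}"
      then have "0 < dist (x k) t" using False by auto
      moreover have "(\<lambda>n. 1 / (real n + 1)) \<longlonglongrightarrow> 0"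
        using LIMSEQ_inverse_real_of_nat by (simp add: inverse_eq_divide add.commute)
      ultimately show "\<forall>\<^sub>F n in sequentially. 1 / (real n + 1) < dist (x k) t"
        by (rule order_tendstoD(2)[rotated])
    qed
    then have "\<forall>\<^sub>F n in sequentially. \<forall>k\<in>{1..K}. 1 / (real n + 1) < dist (x k) t"
      by (intro eventually_ball_finite) auto
    then obtain n where n: "\<forall>k\<in>{1..K}. 1 / (real n + 1) < dist (x k) t"
      by (auto simp: eventually_sequentially)
    then have "t \<notin> ball (x k) (1 / (real n + 1))" if "k \<in> {1..K}" for k
      using that unfolding mem_ball by (meson less_asym)
    then show ?thesis unfolding punctured_nbhd_def by blast
  qed (auto simp: punctured_nbhd_def)
  then show "(\<Inter>n. punctured_nbhd K x n) = {}" by blast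
qed

text \<open>On the neighbourhoods the new \<open>m\<close>-th derivative is zero and satisfies
  either sign condition. A point outside them that is not a change point of \<open>x\<close> has
  distance at least the radius from every \<open>x k\<close>, while \<open>x' k\<close> is closer
  than that, so it lies on the same side of both. The change points of \<open>x\<close> form a null
  set.\<close>

lemma in_V_transfer:
  assumes V: "in_V m p K x' f D" and near: "\<And>k. k \<in> {1..K} \<Longrightarrow> \<bar>x' k - x k\<bar> < 1 / (real n + 1)"
    and g: "sob_derivs m p g E"
    and E: "\<And>t. E m t = indicat_real (- punctured_nbhd K x n) t * D m t"
  shows "in_V m p K x g E"
  unfolding in_V_def
proof (intro conjI ballI)
  show "sob_derivs m p g E" by fact
  fix k assume k: "k \<in> {1..Suc K}"
  have "AE t in lebesgue. t \<notin> x ` {1..K}"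
    by (intro AE_not_in null_sets_completionI finite_imp_null_set_lborel) auto
  moreover have "AE t in lebesgue. t \<in> {ext_pts K x' (k - 1) .. ext_pts K x' k} \<longrightarrow> (-1) ^ (k - 1) * D m t \<ge> 0"
    using V k by (auto simp: in_V_def)
  ultimately show "AE t in lebesgue. t \<in> {ext_pts K x (k - 1) .. ext_pts K x k} \<longrightarrow> (-1) ^ (k - 1) * E m t \<ge> 0"
  proof eventually_elim
    case (elim t)
    show ?case
    proof (cases "t \<in> punctured_nbhd K x n")
      case False
      then have far: "\<bar>x j - t\<bar> \<ge> 1 / (real n + 1)" if "j \<in> {1..K}" for j
        using elim(1) that by (force simp: punctured_nbhd_def dist_real_def)
      have "(ext_pts K x j \<le> t \<longrightarrow> ext_pts K x' j \<le> t) \<and> (t \<le> ext_pts K x j \<longrightarrow> t \<le> ext_pts K x' j)"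
        if "j \<le> Suc K" for j
      proof (cases "j \<in> {1..K}")
        case True
        then show ?thesis using near[OF True] far[OF True] by (auto simp: ext_pts_def)
      qed (use that in \<open>auto simp: ext_pts_def\<close>)
      from this[of "k - 1"] this[of k] show ?thesis using elim(2) False k by (auto simp: E)
    qed (simp add: E)
  qed
qed

text \<open>Suppose some \<open>f\<close> admissible for \<open>x'\<close> has objective below
  \<open>a\<close>. First the energy of \<open>f\<close> is bounded by a constant independent of
  \<open>x'\<close> and \<open>f\<close>; then the competitor built from \<open>f\<close> is
  admissible for \<open>x\<close> with objective below \<open>Phi\<close> at \<open>x\<close>, a
  contradiction. All constants, and hence the radius, are fixed before \<open>x'\<close> and
  \<open>f\<close> appear.\<close>

lemma Phi_lower_semicontinuous:
  fixes L :: "nat \<Rightarrow> (real \<Rightarrow> real) \<Rightarrow> real"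
  assumes p: "1 < p" and lam: "lam > 0"
    and L: "\<forall>i\<in>{1..N}. bounded_linear_functional_W m p (L i)"
    and rho: "\<forall>i\<in>{1..N}. strictly_convex_on UNIV (rho i) \<and> continuous_on UNIV (rho i)"
    and a: "a < Phi m p lam K N L y rho x"
  shows "\<exists>d>0. \<forall>x'. (\<forall>k\<in>{1..K}. \<bar>x' k - x k\<bar> < d) \<longrightarrow> a \<le> Phi m p lam K N L y rho x'"
proof (cases "a = -\<infinity>")
  case True
  then show ?thesis by (intro exI[of _ 1]) auto
next
  case False
  then obtain a' where a': "a = ereal a'" using a by (cases a) auto
  \<comment> \<open>The gap \<open>b - a'\<close> is what the perturbation of \<open>f\<close> may
    cost.\<close>
  obtain b where b: "a' < b" "ereal b < Phi m p lam K N L y rho x"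
    using ereal_dense2[OF a] a' by auto
  define R where "R f = (\<Sum>i=1..N. rho i (L i f - y i))" for f
  have R_conv: "R (\<lambda>t. u * f t + (1 - u) * g t) \<le> u * R f + (1 - u) * R g"
    if "sob_derivs m p f D" "sob_derivs m p g E" "0 \<le> u" "u \<le> 1" for f g D E u
    unfolding R_def using data_term_convex[OF _ L that] rho by blast
  define v where "v i g = L i (iterated_integral m g)" for i g
  have v_lin: "v i (\<lambda>t. a * g t + b * h t) = a * v i g + b * v i h"
    if "i \<in> {1..N}" "Lp_fun p g" "Lp_fun p h" for i g h a b
    unfolding v_def using functional_iterated_integral_lincomb[OF _ p that(2,3)] L that(1) by blast
  have v_scale: "v i (\<lambda>t. a * g t) = a * v i g" if "i \<in> {1..N}" "Lp_fun p g" for i g a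
    using v_lin[OF that(1) that(2) that(2), of a 0] by simp
  have "\<forall>i\<in>{1..N}. \<exists>C. \<forall>g. Lp_fun p g \<longrightarrow> Lp_energy p g \<le> 1 \<longrightarrow> \<bar>v i g\<bar> \<le> C"
    unfolding v_def using functional_iterated_integral_bounded[OF _ p] L by metis
  then obtain c where c: "\<And>i g. i \<in> {1..N} \<Longrightarrow> Lp_fun p g \<Longrightarrow> Lp_energy p g \<le> 1 \<Longrightarrow> \<bar>v i g\<bar> \<le> c i"
    by metis
  define C where "C = (\<Sum>i=1..N. \<bar>c i\<bar>)"
  have C: "0 \<le> C" by (simp add: C_def sum_nonneg)
  have v_bd: "\<bar>v i g\<bar> \<le> C" if "i \<in> {1..N}" "Lp_fun p g" "Lp_energy p g \<le> 1" for i g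
  proof -
    have "\<bar>c i\<bar> \<le> C" unfolding C_def using that(1) by (intro member_le_sum) auto
    then show ?thesis using c[OF that] by linarith
  qed
  have v_bd': "\<bar>v i g\<bar> \<le> C * T" if "i \<in> {1..N}" "Lp_fun p g" "Lp_energy p g \<le> T powr p" "0 < T" for i g T
    by (rule functional_bound_by_energy[OF v_scale[OF that(1)] v_bd[OF that(1)] that(2-4)])
  obtain M1 where M1: "0 \<le> M1"
    "\<And>z. (\<And>i. i \<in> {1..N} \<Longrightarrow> \<bar>z i\<bar> \<le> C) \<Longrightarrow> (\<Sum>i=1..N. rho i (z i - y i)) \<le> M1"
    by (rule data_term_bounded[of N rho "C" y]) (use rho in auto)
  \<comment> \<open>Below, an \<open>f\<close> of norm \<open>T > 1\<close> is shown to satisfy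
    \<open>T powr p < A * T\<close>. As \<open>p > 1\<close>, this forces
    \<open>T \<le> A powr (1 / (p - 1))\<close>, which explains \<open>T0\<close>.\<close>
  define A where "A = (\<bar>a'\<bar> + 2 * \<bar>b\<bar> + M1) * p / lam"
  define T0 where "T0 = max 1 (A powr (1 / (p - 1)))"
  have T0: "1 \<le> T0" by (simp add: T0_def)
  \<comment> \<open>The data of \<open>u\<close> are at most \<open>C * T0\<close> and those of
    \<open>w / \<theta>\<close> at most 1, so \<open>M2\<close> bounds the data term of
    \<open>u - w / \<theta>\<close>.\<close>
  obtain M2 where M2: "0 \<le> M2"
    "\<And>z. (\<And>i. i \<in> {1..N} \<Longrightarrow> \<bar>z i\<bar> \<le> C * T0 + 1) \<Longrightarrow> (\<Sum>i=1..N. rho i (z i - y i)) \<le> M2"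
    by (rule data_term_bounded[of N rho "C * T0 + 1" y]) (use rho in auto)
  define Q where "Q = M2 + lam / p * T0 powr p"
  \<comment> \<open>\<open>Q\<close> will bound the data term of \<open>u - w / \<theta>\<close>
    plus the energy term of \<open>f\<close>. The weight is so small that replacing the fraction
    \<open>\<theta>\<close> of \<open>a'\<close> by \<open>Q\<close> does not exceed
    \<open>b\<close>.\<close>
  define \<theta> where "\<theta> = min (1/2) ((b - a') / (2 * (\<bar>Q\<bar> + \<bar>a'\<bar> + 1)))"
  have \<theta>: "0 < \<theta>" "\<theta> < 1" using b by (auto simp: \<theta>_def)
  have \<theta>b: "(1 - \<theta>) * a' + \<theta> * Q \<le> b"
  proof -
    have "\<theta> * (Q - a') \<le> \<theta> * (2 * (\<bar>Q\<bar> + \<bar>a'\<bar> + 1))"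
      using \<theta> by (intro mult_left_mono) auto
    also have "\<dots> \<le> (b - a') / (2 * (\<bar>Q\<bar> + \<bar>a'\<bar> + 1)) * (2 * (\<bar>Q\<bar> + \<bar>a'\<bar> + 1))"
      by (intro mult_right_mono) (auto simp: \<theta>_def)
    also have "\<dots> = b - a'" by simp
    finally show ?thesis by (simp add: algebra_simps)
  qed
  let ?S = "punctured_nbhd K x"
  \<comment> \<open>The deleted part has norm up to \<open>T0\<close>, so on the unit ball the bound
    must be \<open>\<theta> / T0\<close> to give \<open>\<theta>\<close> after rescaling.\<close>
  have "\<forall>i\<in>{1..N}. \<exists>n. \<forall>g. Lp_fun p g \<longrightarrow> Lp_energy p g \<le> 1 \<longrightarrow> (\<forall>t. t \<notin> ?S n \<longrightarrow> g t = 0) \<longrightarrow> \<bar>v i g\<bar> \<le> \<theta> / T0"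
  proof
    fix i assume i: "i \<in> {1..N}"
    show "\<exists>n. \<forall>g. Lp_fun p g \<longrightarrow> Lp_energy p g \<le> 1 \<longrightarrow> (\<forall>t. t \<notin> ?S n \<longrightarrow> g t = 0) \<longrightarrow> \<bar>v i g\<bar> \<le> \<theta> / T0"
      by (rule functional_small_on_small_support[OF p v_lin[OF i] v_bd[OF i] punctured_nbhd])
        (use \<theta> T0 in auto)
  qed
  then obtain n0 where n0: "\<And>i g. i \<in> {1..N} \<Longrightarrow> Lp_fun p g \<Longrightarrow> Lp_energy p g \<le> 1 \<Longrightarrow> (\<forall>t. t \<notin> ?S (n0 i) \<longrightarrow> g t = 0) \<Longrightarrow> \<bar>v i g\<bar> \<le> \<theta> / T0"
    by metis
  \<comment> \<open>The sum dominates every \<open>n0 i\<close>, so one neighbourhood serves all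
    functionals.\<close>
  define n where "n = (\<Sum>i=1..N. n0 i)"
  have sub: "?S n \<subseteq> ?S (n0 i)" if "i \<in> {1..N}" for i
    using punctured_nbhd(2)[of K x] that unfolding decseq_def n_def by (meson finite_atLeastAtMost member_le_sum zero_le)
  have v_small: "\<bar>v i g\<bar> \<le> \<theta>"
    if i: "i \<in> {1..N}" and g: "Lp_fun p g" "Lp_energy p g \<le> T0 powr p" "\<And>t. t \<notin> ?S n \<Longrightarrow> g t = 0" for i g
  proof -
    have "Lp_energy p (\<lambda>t. (1 / T0) * g t) = (1 / T0) powr p * Lp_energy p g"
      using Lp_fun_scale(2)[OF g(1), of "1 / T0"] T0 by simp
    also have "\<dots> \<le> (1 / T0) powr p * T0 powr p"
      using g(2) by (intro mult_left_mono) auto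
    also have "\<dots> = 1" using T0 by (simp flip: powr_mult)
    finally have "\<bar>v i (\<lambda>t. (1 / T0) * g t)\<bar> \<le> \<theta> / T0"
      using i g sub[OF i] by (intro n0 Lp_fun_scale) auto
    then have "\<bar>1 / T0 * v i g\<bar> \<le> \<theta> / T0"
      unfolding v_scale[OF i g(1)] .
    then show ?thesis using T0 by (simp add: divide_le_cancel)
  qed
  have "a \<le> Phi m p lam K N L y rho x'" if near: "\<forall>k\<in>{1..K}. \<bar>x' k - x k\<bar> < 1 / (real n + 1)" for x'
    unfolding Phi_def
  proof (rule Inf_greatest, clarify)
    fix f D assume V: "in_V m p K x' f D"
    show "a \<le> ereal (objective m p lam N L y rho f D)"
    proof (rule ccontr)
      assume neg: "\<not> ?thesis"
      define e where "e = Lp_energy p (D m)"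
      have J: "lam / p * e + R f < a'"
        using neg by (simp add: a' objective_def R_def e_def Lp_energy_def)
      have f: "sob_derivs m p f D" using V by (simp add: in_V_def)
      have g: "Lp_fun p (D m)" using sob_derivs_top[OF f] .
      define u where "u = iterated_integral m (D m)"
      define U where "U = (\<lambda>k. iterated_integral (m - k) (D m))"
      have u: "sob_derivs m p u U" unfolding u_def U_def by (rule sob_derivs_iterated_integral[OF g p])
      have Um: "U m = D m" by (simp add: U_def)
      \<comment> \<open>The norm of the \<open>m\<close>-th derivative, raised to at least 1 so that
        it can be divided by.\<close>
      define T where "T = max 1 (e powr (1 / p))"
      have T: "1 \<le> T" by (simp add: T_def)
      have e0: "0 \<le> e" by (simp add: e_def Lp_energy_nonneg)
      have eT: "e \<le> T powr p"
      proof -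
        have "e = (e powr (1 / p)) powr p" using p e0 by (simp add: powr_powr)
        also have "\<dots> \<le> T powr p" using p by (intro powr_mono2) (auto simp: T_def)
        finally show ?thesis .
      qed
      have uT: "\<bar>L i u\<bar> \<le> C * T" if "i \<in> {1..N}" for i
        using v_bd'[OF that g] eT T by (simp add: v_def u_def e_def)
      have TT0: "T \<le> T0"
      proof (cases "T = 1")
        case True
        then show ?thesis using T0 by simp
      next
        case False
        then have "T = e powr (1 / p)" by (auto simp: T_def max_def split: if_splits)
        then have Te: "T powr p = e" using p e0 by (simp add: powr_powr)
        \<comment> \<open>A multiple of \<open>f - u\<close>, whose \<open>m\<close>-th derivative vanishes, is a convex combination of \<open>f\<close>
          and \<open>- u / T\<close>; this bounds \<open>R f\<close> from below by a linear function of \<open>T\<close>.\<close>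
        define s where "s = 1 / (1 + T)"
        have s: "0 < s" "s \<le> 1" "1 - s = T / (1 + T)" using T by (auto simp: s_def field_simps)
        define u' where "u' = (\<lambda>t. (- 1 / T) * u t + 0 * u t)"
        have u': "sob_derivs m p u' (\<lambda>k t. (- 1 / T) * U k t + 0 * U k t)"
          unfolding u'_def by (rule sob_derivs_lincomb[OF u u p])
        define q where "q = (\<lambda>t. s * f t + (1 - s) * u' t)"
        define Dq where "Dq = (\<lambda>k t. s * D k t + (1 - s) * ((- 1 / T) * U k t + 0 * U k t))"
        have q: "sob_derivs m p q Dq"
          unfolding q_def Dq_def by (rule sob_derivs_lincomb[OF f u' p])
        \<comment> \<open>The weights satisfy \<open>s = (1 - s) / T\<close>, so the equal
          \<open>m\<close>-th derivatives of \<open>f\<close> and \<open>u\<close> cancel. With zero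
          \<open>m\<close>-th derivative, \<open>q\<close> is admissible for every vector of change
          points.\<close>
        have Dq: "Dq m t = 0" for t
          using T unfolding Dq_def Um s(3) by (simp add: s_def)
        have "in_V m p K x q Dq"
          using q by (simp add: in_V_def Dq)
        then have "b < objective m p lam N L y rho q Dq"
          using b(2) Phi_le_objective by (metis ereal_less(1) less_ereal.simps(1) order_less_le_trans)
        then have "b < R q" using p by (simp add: objective_def R_def Dq)
        also have "R q \<le> s * R f + (1 - s) * R u'"
          unfolding q_def by (rule R_conv[OF f u']) (use s in auto)
        also have "\<dots> \<le> s * R f + (1 - s) * M1"
        proof -
          have "\<bar>L i u'\<bar> \<le> C" if "i \<in> {1..N}" for i
          proof -
            have "L i u' = - (1 / T) * L i u"
              unfolding u'_def using sob_functional_lincomb[OF _ u u, of "L i" "-1/T" 0] L that by simp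
            then have "\<bar>L i u'\<bar> = \<bar>L i u\<bar> / T" using T by (simp add: abs_mult)
            then show ?thesis using uT[OF that] T by (simp add: divide_le_eq)
          qed
          then show ?thesis using M1(2)[of "\<lambda>i. L i u'"] s unfolding R_def by (intro add_left_mono mult_left_mono) auto
        qed
        also have "\<dots> = (R f + T * M1) / (1 + T)"
          unfolding s(3) by (simp add: s_def add_divide_distrib)
        finally have "b * (1 + T) < R f + T * M1"
          using T by (simp add: pos_less_divide_eq)
        then have "lam / p * e < a' + T * M1 - b * (1 + T)" using J by linarith
        also have "\<dots> \<le> T * (\<bar>a'\<bar> + 2 * \<bar>b\<bar> + M1)"
        proof -
          have "a' \<le> T * \<bar>a'\<bar>" using T mult_right_mono[of 1 T "\<bar>a'\<bar>"] by simp
          moreover have "- b * (1 + T) \<le> \<bar>b\<bar> * (2 * T)"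
            using T by (intro mult_mono) auto
          ultimately show ?thesis by (simp add: algebra_simps)
        qed
        finally have "e < A * T"
          using lam p by (simp add: A_def field_simps)
        moreover have "e = T powr (p - 1) * T"
          using Te T by (simp add: powr_diff)
        ultimately have "T powr (p - 1) < A" using T by simp
        then have "(T powr (p - 1)) powr (1 / (p - 1)) \<le> A powr (1 / (p - 1))"
          using p by (intro powr_mono2) auto
        then have "T \<le> A powr (1 / (p - 1))" using p T by (simp add: powr_powr)
        then show ?thesis by (simp add: T0_def)
      qed
      have eT0: "e \<le> T0 powr p"
        by (rule order_trans[OF eT]) (use TT0 T p in \<open>auto intro!: powr_mono2\<close>)
      \<comment> \<open>The part of the \<open>m\<close>-th derivative to be deleted.\<close>
      define h where "h = (\<lambda>t. indicat_real (?S n) t * D m t)"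
      have h: "Lp_fun p h" "Lp_energy p h \<le> T0 powr p"
        using Lp_fun_restrict[OF g punctured_nbhd(1), of K x n] p eT0 unfolding h_def e_def by auto
      define w where "w = iterated_integral m h"
      define W where "W = (\<lambda>k. iterated_integral (m - k) h)"
      have w: "sob_derivs m p w W" unfolding w_def W_def by (rule sob_derivs_iterated_integral[OF h(1) p])
      have Lw: "\<bar>L i w\<bar> \<le> \<theta>" if "i \<in> {1..N}" for i
        using v_small[OF that h] by (simp add: h_def v_def w_def)
      define z where "z = (\<lambda>t. 1 * u t + (- 1 / \<theta>) * w t)"
      define Z where "Z = (\<lambda>k t. 1 * U k t + (- 1 / \<theta>) * W k t)"
      have z: "sob_derivs m p z Z" unfolding z_def Z_def by (rule sob_derivs_lincomb[OF u w p])
      have "\<bar>L i z\<bar> \<le> C * T0 + 1" if i: "i \<in> {1..N}" for i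
      proof -
        have "L i z = L i u - L i w / \<theta>"
          unfolding z_def using sob_functional_lincomb[OF _ u w, of "L i" 1 "-1/\<theta>"] L i by simp
        moreover have "\<bar>L i w / \<theta>\<bar> \<le> 1" using Lw[OF i] \<theta> by simp
        moreover have "\<bar>L i u\<bar> \<le> C * T0"
          using uT[OF i] mult_left_mono[OF TT0 C] by linarith
        ultimately show ?thesis by linarith
      qed
      then have Rz: "R z \<le> M2" unfolding R_def by (rule M2(2))
      \<comment> \<open>The second weight is left unsimplified to match the convexity inequality
        with \<open>u = 1 - \<theta>\<close>.\<close>
      define f' where "f' = (\<lambda>t. (1 - \<theta>) * f t + (1 - (1 - \<theta>)) * z t)"
      define D' where "D' = (\<lambda>k t. (1 - \<theta>) * D k t + (1 - (1 - \<theta>)) * Z k t)"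
      have f': "sob_derivs m p f' D'" unfolding f'_def D'_def by (rule sob_derivs_lincomb[OF f z p])
      \<comment> \<open>\<open>f\<close> and \<open>u\<close> share their \<open>m\<close>-th
        derivative, so mixing them leaves it unchanged; the factor \<open>\<theta>\<close> cancels
        the \<open>1 / \<theta>\<close> in front of \<open>w\<close>, and exactly \<open>h\<close>
        is subtracted.\<close>
      have D'm: "D' m t = indicat_real (- ?S n) t * D m t" for t
        using \<theta> by (auto simp: D'_def Z_def Um W_def h_def indicator_def algebra_simps)
      have "in_V m p K x f' D'"
        by (rule in_V_transfer[OF V _ f' D'm]) (use near in auto)
      then have "b < objective m p lam N L y rho f' D'"
        using b(2) Phi_le_objective by (metis less_ereal.simps(1) order_less_le_trans)
      also have "\<dots> = lam / p * Lp_energy p (D' m) + R f'"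
        by (simp add: objective_def R_def Lp_energy_def)
      also have "\<dots> \<le> lam / p * e + ((1 - \<theta>) * R f + \<theta> * M2)"
      proof (intro add_mono mult_left_mono)
        have "D' m = (\<lambda>t. indicat_real (- ?S n) t * D m t)" using D'm by auto
        moreover have "- ?S n \<in> sets lebesgue"
          using punctured_nbhd(1)[of K x n] sets.compl_sets[of "?S n" lebesgue] by (simp add: Compl_eq_Diff_UNIV)
        ultimately show "Lp_energy p (D' m) \<le> e"
          using Lp_fun_restrict(2)[OF g] p by (simp add: e_def)
        have "R f' \<le> (1 - \<theta>) * R f + (1 - (1 - \<theta>)) * R z"
          unfolding f'_def by (rule R_conv[OF f z]) (use \<theta> in auto)
        also have "\<dots> \<le> (1 - \<theta>) * R f + \<theta> * M2"
          using Rz \<theta> by (simp add: mult_left_mono)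
        finally show "R f' \<le> (1 - \<theta>) * R f + \<theta> * M2" .
      qed (use lam p in auto)
      \<comment> \<open>The energy is split with the same weights, so that the first bracket is the
        objective of \<open>f\<close>, below \<open>a'\<close>, and the second is at most
        \<open>Q\<close>.\<close>
      also have "\<dots> = (1 - \<theta>) * (lam / p * e + R f) + \<theta> * (M2 + lam / p * e)"
        by (simp add: algebra_simps diff_divide_distrib)
      also have "\<dots> \<le> (1 - \<theta>) * a' + \<theta> * Q"
        unfolding Q_def using J \<theta> eT0 lam p by (intro add_mono mult_left_mono) auto
      also have "\<dots> \<le> b" by (rule \<theta>b)
      finally show False by simp
    qed
  qed
  then show ?thesis by (intro exI[of _ "1 / (real n + 1)"]) auto
qed

section \<open>Compactness and existence of optimal change points\<close>

lemma change_pts_bounds: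
  assumes "x \<in> change_pts K" "k \<in> {1..K}"
  shows "0 \<le> x k" "x k \<le> 1"
proof -
  have st: "ext_pts K x j \<le> ext_pts K x (Suc j)" if "j \<le> K" for j
    using assms(1) that by (auto simp: change_pts_def)
  have lo: "0 \<le> ext_pts K x j" if "j \<le> Suc K" for j
    using that
  proof (induction j)
    case (Suc j)
    then show ?case using st[of j] by auto
  qed (simp add: ext_pts_def)
  have hi: "ext_pts K x j \<le> 1" if "j \<le> Suc K" for j
    using that
  proof (induction j rule: inc_induct)
    case (step j)
    then show ?case using st[of j] by auto
  qed (simp add: ext_pts_def)
  show "0 \<le> x k" "x k \<le> 1"
    using lo[of k] hi[of k] assms(2) by (auto simp: ext_pts_def)
qed

theorem theorem3:
  fixes m K N :: nat and p lam :: real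
    and L :: "nat \<Rightarrow> (real \<Rightarrow> real) \<Rightarrow> real"
    and y :: "nat \<Rightarrow> real" and rho :: "nat \<Rightarrow> real \<Rightarrow> real"
  assumes "m \<ge> 1" and "K \<ge> 1" and "1 < p" and "lam > 0"
    and "\<forall>i\<in>{1..N}. bounded_linear_functional_W m p (L i)"
    and "separates_polys m N L"
    and "\<forall>i\<in>{1..N}. strictly_convex_on UNIV (rho i) \<and> continuous_on UNIV (rho i)"
  shows "\<exists>x\<in>change_pts K. \<forall>x'\<in>change_pts K.
           Phi m p lam K N L y rho x \<le> Phi m p lam K N L y rho x'"
proof (rule ccontr)
  let ?\<Phi> = "Phi m p lam K N L y rho"
  \<comment> \<open>\<open>change_pts\<close> leaves the coordinates outside \<open>{1..K}\<close>
    free and is not compact; fixing them at 0 does not affect \<open>Phi\<close> and makes it so, by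
    Tychonoff.\<close>
  define B where "B = {x \<in> change_pts K. \<forall>k. k \<notin> {1..K} \<longrightarrow> x k = 0}"
  assume neg: "\<not> ?thesis"
  have ex: "\<exists>x'\<in>B. ?\<Phi> x' < ?\<Phi> x" if x: "x \<in> B" for x
  proof -
    obtain x' where x': "x' \<in> change_pts K" "?\<Phi> x' < ?\<Phi> x"
      using neg x unfolding B_def by (metis (no_types, lifting) mem_Collect_eq not_le)
    define x'' where "x'' = (\<lambda>k. if k \<in> {1..K} then x' k else 0)"
    have eq: "ext_pts K x'' k = ext_pts K x' k" if "k \<le> Suc K" for k
      using that by (auto simp: ext_pts_def x''_def)
    then have "in_V m p K x'' f D = in_V m p K x' f D" for f D
      unfolding in_V_def by (intro conj_cong refl ball_cong) auto
    then have "?\<Phi> x'' = ?\<Phi> x'" by (simp add: Phi_def)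
    moreover have "x'' \<in> B"
      using x'(1) eq by (auto simp: B_def change_pts_def x''_def)
    ultimately show ?thesis using x'(2) by metis
  qed
  have "compact (Pi UNIV (\<lambda>k. if k \<in> {1..K} then {0..1::real} else {0}))"
  proof -
    have "compactin (product_topology (\<lambda>i. euclidean) UNIV)
        (PiE UNIV (\<lambda>k. if k \<in> {1..K} then {0..1::real} else {0}))"
      unfolding compactin_PiE by auto
    then show ?thesis unfolding euclidean_product_topology by (simp add: PiE_UNIV_domain)
  qed
  moreover have "closed (change_pts K)"
  proof -
    have "continuous_on UNIV (\<lambda>x. ext_pts K x k)" for k
      unfolding ext_pts_def by (cases "k = 0"; cases "k = Suc K") auto
    then have "closed {x. ext_pts K x k \<le> ext_pts K x (Suc k)}" for k
      by (intro closed_Collect_le)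
    then have "closed (\<Inter>k\<in>{..K}. {x. ext_pts K x k \<le> ext_pts K x (Suc k)})"
      by (intro closed_INT) auto
    also have "(\<Inter>k\<in>{..K}. {x. ext_pts K x k \<le> ext_pts K x (Suc k)}) = change_pts K"
      by (auto simp: change_pts_def)
    finally show ?thesis .
  qed
  ultimately have "compact (Pi UNIV (\<lambda>k. if k \<in> {1..K} then {0..1::real} else {0}) \<inter> change_pts K)"
    by (rule compact_Int_closed)
  also have "Pi UNIV (\<lambda>k. if k \<in> {1..K} then {0..1::real} else {0}) \<inter> change_pts K = B"
    using change_pts_bounds[of _ K] by (auto simp: B_def Pi_iff split: if_splits)
  finally have comp: "compact B" .
  obtain imp where imp: "\<And>x. x \<in> B \<Longrightarrow> imp x \<in> B" "\<And>x. x \<in> B \<Longrightarrow> ?\<Phi> (imp x) < ?\<Phi> x"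
    using ex by metis
  \<comment> \<open>By lower semicontinuity the improvement \<open>imp x\<close> beats not only
    \<open>x\<close> but a whole neighbourhood. That set is open in the product topology, since it
    restricts finitely many coordinates.\<close>
  have "\<exists>U. open U \<and> x \<in> U \<and> (\<forall>x'\<in>U. ?\<Phi> (imp x) < ?\<Phi> x')" if x: "x \<in> B" for x
  proof -
    obtain a where a: "?\<Phi> (imp x) < a" "a < ?\<Phi> x"
      using dense[OF imp(2)[OF x]] by blast
    obtain d where d: "d > 0" "\<And>x'. (\<forall>k\<in>{1..K}. \<bar>x' k - x k\<bar> < d) \<Longrightarrow> a \<le> ?\<Phi> x'"
      using Phi_lower_semicontinuous[OF assms(3-5,7) a(2)] by blast
    let ?U = "{x'. \<forall>k\<in>{1..K}. \<bar>x' k - x k\<bar> < d}"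
    have "open (\<Inter>k\<in>{1..K}. {x'. \<bar>x' k - x k\<bar> < d})"
      by (intro open_INT ballI open_Collect_less continuous_intros) auto
    also have "(\<Inter>k\<in>{1..K}. {x'. \<bar>x' k - x k\<bar> < d}) = ?U" by auto
    finally have "open ?U" .
    then show ?thesis
      using d a(1) by (intro exI[of _ ?U]) (auto intro: less_le_trans)
  qed
  then obtain U where U: "\<And>x. x \<in> B \<Longrightarrow> open (U x)" "\<And>x. x \<in> B \<Longrightarrow> x \<in> U x"
    "\<And>x x'. x \<in> B \<Longrightarrow> x' \<in> U x \<Longrightarrow> ?\<Phi> (imp x) < ?\<Phi> x'"
    by metis
  obtain F where F: "F \<subseteq> B" "finite F" "B \<subseteq> (\<Union>x\<in>F. U x)"
    by (rule compactE_image[OF comp, of B U]) (use U in auto)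
  have "(\<lambda>k. if k = 0 \<or> k > K then 0 else 1) \<in> B"
    by (auto simp: B_def change_pts_def ext_pts_def)
  then have "F \<noteq> {}" using F by auto
  then have "Min ((\<lambda>x. ?\<Phi> (imp x)) ` F) \<in> (\<lambda>x. ?\<Phi> (imp x)) ` F"
    using F(2) by (intro Min_in) auto
  then obtain x0 where x0: "x0 \<in> F" "Min ((\<lambda>x. ?\<Phi> (imp x)) ` F) = ?\<Phi> (imp x0)"
    by blast
  have x0_min: "?\<Phi> (imp x0) \<le> ?\<Phi> (imp x)" if "x \<in> F" for x
    unfolding x0(2)[symmetric] using F(2) that by (intro Min_le) auto
  \<comment> \<open>The best of the finitely many improvements lies in some \<open>U x1\<close> and
    is therefore beaten by \<open>imp x1\<close>, against its minimality.\<close>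
  obtain x1 where "x1 \<in> F" "imp x0 \<in> U x1"
    using F imp(1) x0(1) by blast
  then show False
    using U(3) x0_min F(1) by (meson not_le subsetD)
qed

end
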